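(* Let $0<p<2$. (i) In dimension $n=2$: for all integers $1\leq N'<N$, every finite sequence $\mathcal{U}=(u_1,\ldots,u_N)$ of vectors in $\mathbb{R}^2$ and every $v\in\mathbb{S}^{1}$, $$R_{\mathcal{U},v}^{(p)}[1,N]\geq R_{\mathcal{U},v}^{(p)}[1,N']+R_{\mathcal{U},v}^{(p)}[N'+1,N].$$ (ii) For every $n\geq 3$, this inequality does not hold in general: there exist integers $1\leq N'<N$, a sequence $\mathcal{U}=(u_1,\ldots,u_N)$ of vectors in $\mathbb{R}^n$ and $v\in\mathbb{S}^{n-1}$ such that $$R_{\mathcal{U},v}^{(p)}[1,N]< R_{\mathcal{U},v}^{(p)}[1,N']+R_{\mathcal{U},v}^{(p)}[N'+1,N].$$
   Context: For a finite sequence $\mathcal{U}=(u_1,\ldots,u_N)$ in $\mathbb{R}^n$, $v\in\mathbb{S}^{n-1}$, $p>0$ and $1\leq a\leq b\leq N$, set $$R_{\mathcal{U},v}^{(p)}[a,b]=\frac{\displaystyle\sum_{M\subset\{a,\ldots,b\},\ |M|=n}|\det(u_m)_{m\in M}|^p}{\displaystyle\sum_{M\subset\{a,\ldots,b\},\ |M|=n-1}|\det(P_{v^\perp}u_m)_{m\in M}|^p}.$$ Here $P_{v^\perp}$ is the orthogonal projection onto $v^\perp$, and the projected determinant is computed in any orthonormal basis of $v^\perp$ (equivalently, its absolute value is the $(n-1)$-dimensional volume of the parallelotope spanned by the projected vectors). An empty sum is zero, and the ratio is defined to be $0$ when its denominator vanishes. *)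

theory Defs
  imports "Jordan_Normal_Form.Schur_Decomposition"
begin

definition unit_sphere :: "nat \<Rightarrow> real vec set" where
  "unit_sphere n = {v \<in> carrier_vec n. sqrt (v \<bullet> v) = 1}"

definition proj_perp :: "real vec \<Rightarrow> real vec \<Rightarrow> real vec" where
  "proj_perp v x = x - ((x \<bullet> v) / (v \<bullet> v)) \<cdot>\<^sub>v v"

text \<open>The hyperplane orthogonal to a nonzero \<open>v\<close> has dimension \<open>n - 1\<close>, so \<open>n - 1\<close> orthonormal
  vectors in it span it.\<close>

definition orthonormal_basis_perp :: "nat \<Rightarrow> real vec \<Rightarrow> real vec list \<Rightarrow> bool" where
  "orthonormal_basis_perp n v bs \<longleftrightarrow>
     length bs = n - 1 \<and> set bs \<subseteq> carrier_vec n \<and> (\<forall>b\<in>set bs. b \<bullet> v = 0) \<and>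
     (\<forall>i<n - 1. \<forall>j<n - 1. bs ! i \<bullet> bs ! j = (if i = j then 1 else 0))"

definition coord_det :: "nat \<Rightarrow> real vec list \<Rightarrow> real vec list \<Rightarrow> real" where
  "coord_det n bs xs = det (mat (n - 1) (n - 1) (\<lambda>(i, j). xs ! i \<bullet> bs ! j))"

text \<open>The basis is an arbitrary one; its existence and the independence of the absolute value
  from its choice are proved below (\<open>orthonormal_basis_perp_exists\<close>, \<open>abs_coord_det_eq\<close>).\<close>

definition abs_perp_det :: "nat \<Rightarrow> real vec \<Rightarrow> real vec list \<Rightarrow> real" where
  "abs_perp_det n v us =
     \<bar>coord_det n (SOME bs. orthonormal_basis_perp n v bs) (map (proj_perp v) us)\<bar>"

text \<open>The families indexed by \<open>M\<close> are listed in increasing order of the index.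
  Here \<open>0 powr p = 0\<close>, and \<open>x / 0 = 0\<close> provides the convention for a vanishing denominator.\<close>

definition det_ratio :: "nat \<Rightarrow> real \<Rightarrow> (nat \<Rightarrow> real vec) \<Rightarrow> real vec \<Rightarrow> nat \<Rightarrow> nat \<Rightarrow> real" where
  "det_ratio n p u v a b =
     (\<Sum>M | M \<subseteq> {a..b} \<and> card M = n.
        \<bar>det (mat_of_rows n (map u (sorted_list_of_set M)))\<bar> powr p) /
     (\<Sum>M | M \<subseteq> {a..b} \<and> card M = n - 1.
        (abs_perp_det n v (map u (sorted_list_of_set M))) powr p)"


lemma unit_sphere_iff: "v \<in> unit_sphere n \<longleftrightarrow> v \<in> carrier_vec n \<and> v \<bullet> v = 1"
  by (auto simp: unit_sphere_def)

lemma proj_perp_carrier: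
  "v \<in> carrier_vec n \<Longrightarrow> x \<in> carrier_vec n \<Longrightarrow> proj_perp v x \<in> carrier_vec n"
  by (simp add: proj_perp_def)

lemma proj_perp_orthogonal:
  assumes "v \<in> unit_sphere n" "x \<in> carrier_vec n"
  shows "proj_perp v x \<bullet> v = 0"
  using assms
  by (auto simp: unit_sphere_iff proj_perp_def minus_scalar_prod_distrib[of _ n])

lemma orthonormal_basis_perp_exists:
  assumes v: "v \<in> unit_sphere n"
  shows "\<exists>bs. orthonormal_basis_perp n v bs"
proof -
  interpret cof_vec_space n "TYPE(real)" .
  have vc: "v \<in> carrier_vec n" and vv: "v \<bullet> v = 1"
    using v by (auto simp: unit_sphere_iff)
  have v0: "v \<noteq> 0\<^sub>v n" using vv by auto
  define ws where "ws = basis_completion v"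
  note bc = basis_completion[OF vc v0, folded ws_def]
  define us where "us = gram_schmidt n ws"
  note gs = gram_schmidt_result[OF bc(2) bc(4) bc(5) us_def]
  have n0: "n > 0" using vv vc by (cases n) (auto simp: scalar_prod_def)
  obtain ws' where ws': "ws = v # ws'" using bc(6,7) n0 by (cases ws) auto
  have hd: "hd us = v" unfolding us_def ws' using vc by (rule gram_schmidt_hd)
  obtain us' where us': "us = v # us'" using gs(4) bc(6) n0 hd by (cases us) auto
  have len: "length us' = n - 1" using gs(4) bc(6) us' by simp
  have car: "set us' \<subseteq> carrier_vec n" using gs(3) us' by auto
  have orth: "(us ! i \<bullet> us ! j = 0) = (i \<noteq> j)" if "i < n" "j < n" for i j
    using corthogonalD[OF gs(2), of i j] that gs(4) bc(6) by (simp add: conjugate_vec_def vec_eq_iff)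
  have orth': "(us' ! i \<bullet> us' ! j = 0) = (i \<noteq> j)" if "i < n - 1" "j < n - 1" for i j
    using orth[of "Suc i" "Suc j"] that us' by auto
  have perp: "us' ! i \<bullet> v = 0" if "i < n - 1" for i
    using orth[of "Suc i" 0] that us' by auto
  define f where "f = (\<lambda>x :: real vec. (1 / sqrt (x \<bullet> x)) \<cdot>\<^sub>v x)"
  have ci: "us' ! i \<in> carrier_vec n" if "i < n - 1" for i
    using car len that by (auto simp: subset_iff)
  have nn: "us' ! i \<bullet> us' ! i > 0" if "i < n - 1" for i
  proof -
    have "us' ! i \<bullet> us' ! i \<ge> 0" by (auto simp: scalar_prod_def intro: sum_nonneg)
    thus ?thesis using orth'[OF that that] by linarith
  qed
  have "orthonormal_basis_perp n v (map f us')"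
    unfolding orthonormal_basis_perp_def
  proof (intro conjI allI impI)
    show "length (map f us') = n - 1" using len by simp
    show "set (map f us') \<subseteq> carrier_vec n" using car by (auto simp: f_def)
    show "\<forall>b\<in>set (map f us'). b \<bullet> v = 0"
      using perp ci vc len by (auto simp: f_def in_set_conv_nth)
    fix i j assume ij: "i < n - 1" "j < n - 1"
    have "map f us' ! i \<bullet> map f us' ! j =
      (us' ! i \<bullet> us' ! j) / (sqrt (us' ! i \<bullet> us' ! i) * sqrt (us' ! j \<bullet> us' ! j))"
      using ij len ci[OF ij(1)] ci[OF ij(2)] by (simp add: f_def)
    also have "\<dots> = (if i = j then 1 else 0)"
      using orth'[OF ij] nn[OF ij(1)] by auto
    finally show "map f us' ! i \<bullet> map f us' ! j = (if i = j then 1 else 0)" .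
  qed
  thus ?thesis by blast
qed

lemma coord_det_square:
  assumes v: "v \<in> unit_sphere n" and bs: "orthonormal_basis_perp n v bs"
    and xs: "length xs = n - 1" "set xs \<subseteq> carrier_vec n" "\<And>x. x \<in> set xs \<Longrightarrow> x \<bullet> v = 0"
  shows "(coord_det n bs xs)\<^sup>2 = det (mat (n - 1) (n - 1) (\<lambda>(i, k). xs ! i \<bullet> xs ! k))"
proof -
  have vc: "v \<in> carrier_vec n" and vv: "v \<bullet> v = 1"
    using v by (auto simp: unit_sphere_iff)
  have n0: "n > 0" using vv vc by (cases n) (auto simp: scalar_prod_def)
  have lb: "length bs = n - 1" and cb: "set bs \<subseteq> carrier_vec n"
    and pb: "\<And>b. b \<in> set bs \<Longrightarrow> b \<bullet> v = 0"
    and ob: "\<And>i j. i < n - 1 \<Longrightarrow> j < n - 1 \<Longrightarrow> bs ! i \<bullet> bs ! j = (if i = j then 1 else 0)"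
    using bs unfolding orthonormal_basis_perp_def by auto
  define cs where "cs = bs @ [v]"
  have lc: "length cs = n" using lb n0 by (simp add: cs_def)
  have cc: "set cs \<subseteq> carrier_vec n" using cb vc by (simp add: cs_def)
  have cci: "cs ! i \<in> carrier_vec n" if "i < n" for i
    using cc that lc by (auto simp: subset_iff)
  have oc: "cs ! i \<bullet> cs ! j = (if i = j then 1 else 0)" if ij: "i < n" "j < n" for i j
  proof -
    have *: "v \<bullet> bs ! k = 0" "bs ! k \<bullet> v = 0" if "k < n - 1" for k
      using pb[of "bs ! k"] that lb cb vc comm_scalar_prod[of "bs ! k" n v]
      by (auto simp: subset_iff)
    show ?thesis
      using ij ob * vv lb by (auto simp: cs_def nth_append)
  qed
  define C where "C = mat_of_rows n cs"
  have C: "C \<in> carrier_mat n n" using lc by (auto simp: C_def mat_of_rows_def)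
  have rC: "row C i = cs ! i" if "i < n" for i
    using that lc cci by (simp add: C_def)
  have "C * C\<^sup>T = 1\<^sub>m n"
    using C by (intro eq_matI) (auto simp: rC oc)
  hence CC: "C\<^sup>T * C = 1\<^sub>m n"
    using mat_mult_left_right_inverse[OF C] C by simp
  define X where "X = mat_of_rows n xs"
  have X: "X \<in> carrier_mat (n - 1) n" using xs by (auto simp: X_def mat_of_rows_def)
  have rX: "row X i = xs ! i" if "i < n - 1" for i
    using that xs by (simp add: X_def subset_iff)
  have "X * X\<^sup>T = X * (C\<^sup>T * C) * X\<^sup>T" using CC X by simp
  also have "\<dots> = (X * C\<^sup>T) * (C * X\<^sup>T)"
    using X C by (smt (verit) assoc_mult_mat mult_carrier_mat transpose_carrier_mat)
  finally have XX: "X * X\<^sup>T = (X * C\<^sup>T) * (C * X\<^sup>T)" .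
  define A where "A = mat (n - 1) (n - 1) (\<lambda>(i, j). xs ! i \<bullet> bs ! j)"
  have A: "A \<in> carrier_mat (n - 1) (n - 1)" by (simp add: A_def)
  have gram: "mat (n - 1) (n - 1) (\<lambda>(i, k). xs ! i \<bullet> xs ! k) = A * A\<^sup>T"
  proof (rule eq_matI)
    fix i k assume "i < dim_row (A * A\<^sup>T)" "k < dim_col (A * A\<^sup>T)"
    hence ik: "i < n - 1" "k < n - 1" using A by auto
    have xc: "xs ! i \<in> carrier_vec n" if "i < n - 1" for i using xs that by (auto simp: subset_iff)
    have xv: "xs ! i \<bullet> v = 0" if "i < n - 1" for i using xs that by auto
    have "xs ! i \<bullet> xs ! k = (X * X\<^sup>T) $$ (i, k)" using ik X by (simp add: rX)
    also have "\<dots> = (\<Sum>j<n. (xs ! i \<bullet> cs ! j) * (cs ! j \<bullet> xs ! k))"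
    proof -
      have 1: "row (X * C\<^sup>T) i = vec n (\<lambda>j. xs ! i \<bullet> cs ! j)"
        using ik X C by (intro eq_vecI) (auto simp: rX rC)
      have 2: "col (C * X\<^sup>T) k = vec n (\<lambda>j. cs ! j \<bullet> xs ! k)"
        using ik X C by (intro eq_vecI) (auto simp: rX rC)
      have "((X * C\<^sup>T) * (C * X\<^sup>T)) $$ (i, k) = row (X * C\<^sup>T) i \<bullet> col (C * X\<^sup>T) k"
        using ik X C by (intro index_mult_mat) auto
      thus ?thesis unfolding XX 1 2 by (simp add: scalar_prod_def[of "vec _ _"] atLeast0LessThan)
    qed
    also have "\<dots> = (\<Sum>j<n. (xs ! i \<bullet> cs ! j) * (xs ! k \<bullet> cs ! j))"
      using cci xc[OF ik(2)] by (intro sum.cong refl) (auto simp: comm_scalar_prod[of _ n])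
    also have "\<dots> = (\<Sum>j<Suc (n - 1). (xs ! i \<bullet> cs ! j) * (xs ! k \<bullet> cs ! j))"
      using n0 by simp
    also have "\<dots> = (\<Sum>j<n - 1. (xs ! i \<bullet> bs ! j) * (xs ! k \<bullet> bs ! j))"
      using lb xv[OF ik(1)] by (simp add: cs_def nth_append)
    also have "\<dots> = (A * A\<^sup>T) $$ (i, k)"
      using ik by (simp add: A_def scalar_prod_def[of "vec _ _"] atLeast0LessThan)
    finally show "mat (n - 1) (n - 1) (\<lambda>(i, k). xs ! i \<bullet> xs ! k) $$ (i, k) = (A * A\<^sup>T) $$ (i, k)"
      using ik by simp
  qed (use A in auto)
  have "det (A * A\<^sup>T) = (det A)\<^sup>2"
    using A by (simp add: det_mult[of _ "n - 1"] det_transpose[of _ "n - 1"] power2_eq_square)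
  thus ?thesis unfolding gram coord_det_def A_def by simp
qed

lemma abs_coord_det_eq:
  assumes v: "v \<in> unit_sphere n" and bs: "orthonormal_basis_perp n v bs"
    and us: "length us = n - 1" "set us \<subseteq> carrier_vec n"
  shows "\<bar>coord_det n bs (map (proj_perp v) us)\<bar> = abs_perp_det n v us"
proof -
  have vc: "v \<in> carrier_vec n" using v by (auto simp: unit_sphere_iff)
  let ?bs = "SOME bs. orthonormal_basis_perp n v bs"
  have bs': "orthonormal_basis_perp n v ?bs"
    using orthonormal_basis_perp_exists[OF v] by (rule someI_ex)
  have xs: "length (map (proj_perp v) us) = n - 1" "set (map (proj_perp v) us) \<subseteq> carrier_vec n"
    "\<And>x. x \<in> set (map (proj_perp v) us) \<Longrightarrow> x \<bullet> v = 0"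
    using us proj_perp_carrier[OF vc] proj_perp_orthogonal[OF v] by (auto simp: subset_iff)
  have "(coord_det n bs (map (proj_perp v) us))\<^sup>2 = (coord_det n ?bs (map (proj_perp v) us))\<^sup>2"
    by (simp only: coord_det_square[OF v bs xs] coord_det_square[OF v bs' xs])
  thus ?thesis unfolding abs_perp_det_def by (simp add: power2_eq_iff abs_eq_iff)
qed

end

theory Submission
  imports "HOL-Analysis.Generalised_Binomial_Theorem" Defs
begin

text \<open>
  In the plane, write every vector in the orthonormal frame given by \<open>v\<close> and its normal, with
  coordinates \<open>(x, y)\<close>, \<open>x\<close> being the coordinate along \<open>v\<^sup>\<bottom>\<close>. The denominator of a family is
  \<open>D = \<Sum> \<bar>x\<^sub>i\<bar>\<^sup>p\<close>, and its numerator \<open>F\<close> is the sum over pairs of \<open>\<bar>x\<^sub>i y\<^sub>j - x\<^sub>j y\<^sub>i\<bar>\<^sup>p\<close>. For two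
  families \<open>A\<close> and \<open>B\<close>, with \<open>C\<close> the sum of the same kernel over \<open>A \<times> B\<close>, clearing denominators
  turns superadditivity into \<open>D\<^sub>B\<^sup>2 F\<^sub>A + D\<^sub>A\<^sup>2 F\<^sub>B \<le> D\<^sub>A D\<^sub>B C\<close>. This says that
  the quadratic form of the kernel is nonpositive at the weights \<open>D\<^sub>B\<close> on \<open>A\<close> and \<open>- D\<^sub>A\<close> on \<open>B\<close>, which
  are orthogonal to \<open>\<bar>x\<bar>\<^sup>p\<close>. So it suffices that \<open>\<bar>x\<^sub>i y\<^sub>j - x\<^sub>j y\<^sub>i\<bar>\<^sup>p\<close> is negative semidefinite on that
  hyperplane (\<open>det_powr_conditionally_negative\<close>), a homogeneous version of the fact that
  \<open>\<bar>s - t\<bar>\<^sup>p\<close> is conditionally negative definite for \<open>0 < p < 2\<close>. For unit vectors,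
  \<open>\<bar>det\<bar>\<^sup>p = (1 - \<langle>\<cdot>, \<cdot>\<rangle>\<^sup>2)\<^bsup>p/2\<^esup>\<close>, and all nonconstant terms of its binomial series are negative multiples
  of powers of the inner product, which are positive semidefinite kernels; a rescaling of the
  plane along \<open>v\<close>, under which the determinant is homogeneous, then passes from \<open>\<bar>(x, y)\<bar>\<^sup>p\<close> to
  \<open>\<bar>x\<bar>\<^sup>p\<close>.

  In space, take three plane directions \<open>d\<^sub>1, d\<^sub>2, d\<^sub>3\<close> with sum zero, any two of them
  spanning unit area, and families of vectors \<open>d\<^sub>i + t v\<close>. Three vectors with different directions
  have determinant \<open>\<plusminus>(t\<^sub>1 + t\<^sub>2 + t\<^sub>3)\<close>, two on one line and one on another have \<open>\<plusminus>(t - t')\<close>. Put the first two lines into \<open>A\<close> and the third,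
  with a negligible share of the first, into \<open>B\<close>. If the three lines have equal
  weight and their slopes the same symmetric distribution \<open>X\<close>, superadditivity fails as soon as
  \<open>E \<bar>X\<^sub>1 + X\<^sub>2 + X\<^sub>3\<bar>\<^sup>p < 3/2 E \<bar>X\<^sub>1 - X\<^sub>2\<bar>\<^sup>p\<close> for independent copies. At \<open>p = 2\<close> both sides agree, and
  for Gaussian slopes the quotient of the two sides is \<open>(3/2)\<^bsup>p/2 - 1\<^esup> < 1\<close> when \<open>p < 2\<close>. The slopes
  \<open>-1, 0, 0, 1\<close>, with a single vector of the first line in \<open>B\<close>, are close enough to this situation:
  the failure reduces to \<open>3\<^sup>p < 5 + 2\<^sup>p\<close>
  (\<open>list_ratio_3\<close>, \<open>three_powr_less\<close>). Higher dimensions follow by adjoining one new orthonormal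
  vector to each of the two families, which changes none of the three ratios
  (\<open>list_ratio_coloop\<close>).
\<close>

(* The symbols $ and \<bullet> denote entries and scalar product of vectors of variable dimension. *)
unbundle no vec_syntax
unbundle no inner_syntax

section \<open>A conditionally negative kernel in the plane\<close>

text \<open>
  The kernel \<open>\<langle>u, w\<rangle>\<^sup>m\<close> is the inner product of the tensor powers of \<open>u\<close> and \<open>w\<close>; expanding by the
  binomial theorem makes its quadratic form a nonnegative combination of squares.
\<close>
lemma power_of_inner_product_psd:
  fixes w a b :: "'i \<Rightarrow> real"
  shows "0 \<le> (\<Sum>i\<in>I. \<Sum>j\<in>I. w i * w j * (a i * a j + b i * b j) ^ m)"
proof -
  have "(\<Sum>i\<in>I. \<Sum>j\<in>I. w i * w j * (a i * a j + b i * b j) ^ m)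
      = (\<Sum>i\<in>I. \<Sum>j\<in>I. \<Sum>l\<le>m. real (m choose l) *
          ((w i * a i ^ l * b i ^ (m - l)) * (w j * a j ^ l * b j ^ (m - l))))"
    by (intro sum.cong refl)
       (simp add: binomial_ring sum_distrib_left power_mult_distrib mult_ac)
  also have "\<dots> = (\<Sum>i\<in>I. \<Sum>l\<le>m. \<Sum>j\<in>I. real (m choose l) *
          ((w i * a i ^ l * b i ^ (m - l)) * (w j * a j ^ l * b j ^ (m - l))))"
    by (intro sum.cong refl sum.swap)
  also have "\<dots> = (\<Sum>l\<le>m. \<Sum>i\<in>I. \<Sum>j\<in>I. real (m choose l) *
          ((w i * a i ^ l * b i ^ (m - l)) * (w j * a j ^ l * b j ^ (m - l))))"
    by (rule sum.swap)
  also have "\<dots> = (\<Sum>l\<le>m. real (m choose l) * (\<Sum>i\<in>I. w i * a i ^ l * b i ^ (m - l))\<^sup>2)"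
    unfolding power2_eq_square sum_product by (simp add: sum_distrib_left)
  finally show ?thesis by (simp add: sum_nonneg)
qed

lemma gbinomial_alternating_nonpos:
  fixes q :: real
  assumes "0 < q" "q < 1"
  shows "(q gchoose Suc k) * (- 1) ^ Suc k \<le> 0"
proof -
  have "0 \<le> pochhammer (1 - q) k"
    using assms by (auto simp: pochhammer_prod intro!: prod_nonneg)
  hence "pochhammer (- q) (Suc k) \<le> 0"
    using assms by (simp add: pochhammer_rec mult_nonneg_nonneg)
  moreover have "(q gchoose Suc k) * (- 1) ^ Suc k = pochhammer (- q) (Suc k) / fact (Suc k)"
    by (simp add: gbinomial_pochhammer flip: power_mult_distrib)
  ultimately show ?thesis by (simp add: divide_nonpos_pos del: fact_Suc)
qed

text \<open>
  In the expansion of \<open>(1 - r z)\<^sup>q\<close> with \<open>z = \<langle>\<cdot>, \<cdot>\<rangle>\<^sup>2\<close> only the constant term contributes positively to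
  the quadratic form, and its contribution is \<open>(\<Sum> w)\<^sup>2\<close>. The factor \<open>r < 1\<close> keeps the series inside its
  disc of convergence even on the diagonal, where \<open>z\<close> may be \<open>1\<close>.
\<close>
lemma powr_one_minus_kernel_le:
  fixes w a b :: "'i \<Rightarrow> real"
  assumes q: "0 < q" "q < 1" and r: "0 \<le> r" "r < 1"
    and ab: "\<And>i j. i \<in> I \<Longrightarrow> j \<in> I \<Longrightarrow> (a i * a j + b i * b j)\<^sup>2 \<le> 1"
  shows "(\<Sum>i\<in>I. \<Sum>j\<in>I. w i * w j * (1 - r * (a i * a j + b i * b j)\<^sup>2) powr q) \<le> (\<Sum>i\<in>I. w i)\<^sup>2"
proof -
  define z where "z = (\<lambda>i j. (a i * a j + b i * b j)\<^sup>2)"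
  define S where "S = (\<lambda>k. \<Sum>i\<in>I. \<Sum>j\<in>I. w i * w j * z i j ^ k)"
  define f where "f = (\<lambda>k. (q gchoose k) * (- 1) ^ k * (r ^ k * S k))"
  have "(\<lambda>k. \<Sum>i\<in>I. \<Sum>j\<in>I. w i * w j * ((q gchoose k) * (- (r * z i j)) ^ k))
      sums (\<Sum>i\<in>I. \<Sum>j\<in>I. w i * w j * (1 + - (r * z i j)) powr q)"
  proof (intro sums_sum sums_mult gen_binomial_real)
    fix i j assume "i \<in> I" "j \<in> I"
    hence z: "0 \<le> z i j" "z i j \<le> 1" using ab by (auto simp: z_def)
    have "r * z i j \<le> r * 1" using z r by (intro mult_left_mono) auto
    thus "\<bar>- (r * z i j)\<bar> < 1" using z r by (simp add: abs_mult)
  qed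
  moreover have "(\<Sum>i\<in>I. \<Sum>j\<in>I. w i * w j * ((q gchoose k) * (- (r * z i j)) ^ k)) = f k" for k
  proof -
    have "(- (r * z i j)) ^ k = (- 1) ^ k * r ^ k * z i j ^ k" for i j
      by (metis mult.assoc mult_minus1 power_mult_distrib)
    thus ?thesis by (simp add: f_def S_def sum_distrib_left mult_ac)
  qed
  ultimately have sums: "f sums (\<Sum>i\<in>I. \<Sum>j\<in>I. w i * w j * (1 - r * z i j) powr q)" (is "_ sums ?s")
    by simp
  have S: "0 \<le> S k" for k
    using power_of_inner_product_psd[of w a b "2 * k" I] by (simp add: S_def z_def power_mult)
  have tail: "(\<lambda>k. f (Suc k)) sums (?s - f 0)"
    using sums by (simp add: sums_Suc_iff)
  have "f (Suc k) \<le> 0" for k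
    unfolding f_def using gbinomial_alternating_nonpos[OF q, of k] S[of "Suc k"] r
    by (intro mult_nonpos_nonneg[OF _ mult_nonneg_nonneg] zero_le_power)
  hence "?s - f 0 \<le> 0"
    by (rule sums_le[OF _ tail sums_zero])
  moreover have "f 0 = (\<Sum>i\<in>I. w i)\<^sup>2"
    by (simp add: f_def S_def power2_eq_square sum_product)
  ultimately show ?thesis by (simp add: z_def)
qed

lemma power2_powr_half: "(t\<^sup>2) powr (p / 2) = \<bar>t\<bar> powr p" for t p :: real
proof -
  have "t\<^sup>2 = \<bar>t\<bar> powr 2" by simp
  thus ?thesis by (simp only: powr_powr) simp
qed

text \<open>
  Normalising the vectors turns \<open>det\<^sup>2\<close> into \<open>1 - z\<close> by Lagrange's identity; the norms go into the
  weights, and the previous bound is used in the limit \<open>r \<rightarrow> 1\<close>.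
\<close>
lemma det_powr_kernel_le:
  fixes c x y :: "'i \<Rightarrow> real"
  assumes p: "0 < p" "p < 2"
  shows "(\<Sum>i\<in>I. \<Sum>j\<in>I. c i * c j * \<bar>x i * y j - x j * y i\<bar> powr p)
    \<le> (\<Sum>i\<in>I. c i * ((x i)\<^sup>2 + (y i)\<^sup>2) powr (p / 2))\<^sup>2"
proof -
  define N where "N = (\<lambda>i. (x i)\<^sup>2 + (y i)\<^sup>2)"
  define a where "a = (\<lambda>i. x i / sqrt (N i))"
  define b where "b = (\<lambda>i. y i / sqrt (N i))"
  define w where "w = (\<lambda>i. c i * N i powr (p / 2))"
  define z where "z = (\<lambda>i j. (a i * a j + b i * b j)\<^sup>2)"
  (* For a zero vector, division by zero gives a = b = 0, and every formula below stays valid. *)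
  have N0: "0 \<le> N i" for i by (simp add: N_def)
  have z: "z i j = (x i * x j + y i * y j)\<^sup>2 / (N i * N j)" for i j
    using N0 by (simp add: z_def a_def b_def power_divide power_mult_distrib real_sqrt_mult[symmetric]
        flip: add_divide_distrib)
  have lagrange: "N i * N j = (x i * y j - x j * y i)\<^sup>2 + (x i * x j + y i * y j)\<^sup>2" for i j
    unfolding N_def by (simp add: power2_eq_square algebra_simps)
  have split: "(x i * y j - x j * y i)\<^sup>2 = N i * N j * (1 - z i j)" for i j
  proof (cases "N i * N j = 0")
    case True
    thus ?thesis using lagrange[of i j] by (simp add: sum_power2_eq_zero_iff)
  next
    case False
    thus ?thesis using lagrange[of i j] by (simp add: z field_simps)
  qed
  have z1: "z i j \<le> 1" for i j
    using N0[of i] N0[of j] lagrange[of i j] unfolding z by (intro divide_le_eq_1[THEN iffD2]) (smt (verit) zero_le_power2)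
  have kernel: "c i * c j * \<bar>x i * y j - x j * y i\<bar> powr p = w i * w j * (1 - z i j) powr (p / 2)" for i j
  proof -
    have "\<bar>x i * y j - x j * y i\<bar> powr p = (N i * N j * (1 - z i j)) powr (p / 2)"
      by (simp add: power2_powr_half flip: split)
    also have "\<dots> = N i powr (p / 2) * N j powr (p / 2) * (1 - z i j) powr (p / 2)"
      using N0 z1 by (simp add: powr_mult)
    finally show ?thesis by (simp add: w_def)
  qed
  have "(\<Sum>i\<in>I. \<Sum>j\<in>I. w i * w j * (1 - 1 * z i j) powr (p / 2)) \<le> (\<Sum>i\<in>I. w i)\<^sup>2"
  proof (rule tendsto_upperbound)
    show "((\<lambda>r. \<Sum>i\<in>I. \<Sum>j\<in>I. w i * w j * (1 - r * z i j) powr (p / 2))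
        \<longlongrightarrow> (\<Sum>i\<in>I. \<Sum>j\<in>I. w i * w j * (1 - 1 * z i j) powr (p / 2))) (at_left 1)"
    proof (intro tendsto_sum tendsto_mult tendsto_const tendsto_powr')
      fix i j
      show "((\<lambda>r. 1 - r * z i j) \<longlongrightarrow> 1 - 1 * z i j) (at_left 1)"
        by (intro tendsto_intros)
      have "\<forall>\<^sub>F r in at_left 1. r \<in> {0<..<1::real}"
        by (rule eventually_at_left_real) simp
      hence "\<forall>\<^sub>F r in at_left 1. 0 \<le> 1 - r * z i j"
      proof eventually_elim
        case (elim r)
        hence r: "0 < r" "r < 1" by auto
        hence "r * z i j \<le> r * 1" using z1[of i j] by (intro mult_left_mono) auto
        thus ?case using r by linarith
      qed
      thus "1 - 1 * z i j \<noteq> 0 \<or> (0 < p / 2 \<and> (\<forall>\<^sub>F r in at_left 1. 0 \<le> 1 - r * z i j))"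
        using p by simp
    qed
    have "\<forall>\<^sub>F r in at_left 1. r \<in> {0<..<1::real}"
      by (rule eventually_at_left_real) simp
    thus "\<forall>\<^sub>F r in at_left 1. (\<Sum>i\<in>I. \<Sum>j\<in>I. w i * w j * (1 - r * z i j) powr (p / 2)) \<le> (\<Sum>i\<in>I. w i)\<^sup>2"
    proof eventually_elim
      case (elim r)
      hence r: "0 \<le> r" "r < 1" by auto
      have q: "0 < p / 2" "p / 2 < 1" using p by auto
      show ?case
        unfolding z_def by (rule powr_one_minus_kernel_le[OF q r]) (rule z1[unfolded z_def])
    qed
  qed simp
  hence "(\<Sum>i\<in>I. \<Sum>j\<in>I. w i * w j * (1 - z i j) powr (p / 2)) \<le> (\<Sum>i\<in>I. w i)\<^sup>2"
    by simp
  thus ?thesis unfolding kernel by (simp only: w_def N_def)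
qed

lemma powr_add_le:
  fixes s t q :: real
  assumes "0 < q" "q \<le> 1" "0 \<le> s" "0 \<le> t"
  shows "(s + t) powr q \<le> s powr q + t powr q"
proof (cases "s + t = 0")
  case False
  hence pos: "0 < s + t" using assms by linarith
  have *: "u / (s + t) \<le> u powr q / (s + t) powr q" if "0 \<le> u" "u \<le> s + t" for u
  proof -
    have "(u / (s + t)) powr 1 \<le> (u / (s + t)) powr q"
      using that pos assms by (intro powr_mono') auto
    thus ?thesis using that pos by (simp add: powr_divide)
  qed
  have "1 = s / (s + t) + t / (s + t)" using pos by (simp flip: add_divide_distrib)
  also have "\<dots> \<le> s powr q / (s + t) powr q + t powr q / (s + t) powr q"
    using assms by (intro add_mono *) auto
  finally show ?thesis using pos by (simp add: field_simps)
qed (use assms in auto)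

text \<open>
  Apply the preceding bound to the vectors \<open>(x, e y)\<close>. The left side scales by \<open>d = e\<^sup>p\<close>. On the
  right, the hypothesis removes the main term \<open>\<Sum> c \<bar>x\<bar>\<^sup>p\<close>, and subadditivity of \<open>t \<mapsto> t\<^bsup>p/2\<^esup>\<close> bounds the
  rest by a multiple of \<open>d\<close> before squaring. The right side is thus of order \<open>d\<^sup>2\<close>, and \<open>d \<rightarrow> 0\<close>
  gives the claim.
\<close>
lemma det_powr_conditionally_negative:
  fixes c x y :: "'i \<Rightarrow> real"
  assumes p: "0 < p" "p < 2" and c: "(\<Sum>i\<in>I. c i * \<bar>x i\<bar> powr p) = 0"
  shows "(\<Sum>i\<in>I. \<Sum>j\<in>I. c i * c j * \<bar>x i * y j - x j * y i\<bar> powr p) \<le> 0" (is "?S \<le> 0")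
proof -
  define K where "K = (\<Sum>i\<in>I. \<bar>c i\<bar> * \<bar>y i\<bar> powr p)"
  have bound: "?S \<le> d * K\<^sup>2" if d: "0 < d" for d :: real
  proof -
    define e where "e = d powr (1 / p)"
    have e: "0 < e" "e powr p = d" using d p by (auto simp: e_def powr_powr)
    have scale: "\<bar>e * t\<bar> powr p = d * \<bar>t\<bar> powr p" for t
      using e by (simp add: abs_mult powr_mult)
    have "d * ?S = (\<Sum>i\<in>I. \<Sum>j\<in>I. c i * c j * \<bar>x i * (e * y j) - x j * (e * y i)\<bar> powr p)"
    proof -
      have "\<bar>x i * (e * y j) - x j * (e * y i)\<bar> powr p = d * \<bar>x i * y j - x j * y i\<bar> powr p" for i j
      proof -
        have "x i * (e * y j) - x j * (e * y i) = e * (x i * y j - x j * y i)"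
          by (simp add: algebra_simps)
        thus ?thesis by (simp only: scale)
      qed
      thus ?thesis by (simp add: sum_distrib_left mult_ac)
    qed
    also have "\<dots> \<le> (\<Sum>i\<in>I. c i * ((x i)\<^sup>2 + (e * y i)\<^sup>2) powr (p / 2))\<^sup>2"
      by (rule det_powr_kernel_le[OF p])
    also have "\<dots> = (\<Sum>i\<in>I. c i * (((x i)\<^sup>2 + (e * y i)\<^sup>2) powr (p / 2) - \<bar>x i\<bar> powr p))\<^sup>2"
      using c by (simp add: right_diff_distrib sum_subtractf)
    also have "\<dots> \<le> (d * K)\<^sup>2"
    proof (rule power2_le_iff_abs_le[THEN iffD2])
      show "0 \<le> d * K" using d by (simp add: K_def sum_nonneg)
      have "\<bar>\<Sum>i\<in>I. c i * (((x i)\<^sup>2 + (e * y i)\<^sup>2) powr (p / 2) - \<bar>x i\<bar> powr p)\<bar>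
        \<le> (\<Sum>i\<in>I. \<bar>c i\<bar> * (d * \<bar>y i\<bar> powr p))"
      proof (rule order_trans[OF sum_abs], rule sum_mono)
        fix i
        have "((x i)\<^sup>2 + (e * y i)\<^sup>2) powr (p / 2) \<le> \<bar>x i\<bar> powr p + d * \<bar>y i\<bar> powr p"
          using powr_add_le[of "p / 2" "(x i)\<^sup>2" "(e * y i)\<^sup>2"] p
          unfolding power2_powr_half scale by simp
        moreover have "\<bar>x i\<bar> powr p \<le> ((x i)\<^sup>2 + (e * y i)\<^sup>2) powr (p / 2)"
          using p unfolding power2_powr_half[symmetric] by (intro powr_mono2) auto
        ultimately show "\<bar>c i * (((x i)\<^sup>2 + (e * y i)\<^sup>2) powr (p / 2) - \<bar>x i\<bar> powr p)\<bar>
            \<le> \<bar>c i\<bar> * (d * \<bar>y i\<bar> powr p)"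
          by (auto simp: abs_mult intro!: mult_left_mono)
      qed
      thus "\<bar>\<Sum>i\<in>I. c i * (((x i)\<^sup>2 + (e * y i)\<^sup>2) powr (p / 2) - \<bar>x i\<bar> powr p)\<bar> \<le> d * K"
        by (simp add: K_def sum_distrib_left mult_ac)
    qed
    finally have "d * ?S \<le> d * (d * K\<^sup>2)" by (simp add: power2_eq_square mult_ac)
    thus ?thesis using d by simp
  qed
  have "?S \<le> 0 + \<epsilon>" if "0 < \<epsilon>" for \<epsilon>
  proof -
    have "?S \<le> \<epsilon> / (K\<^sup>2 + 1) * K\<^sup>2" using that by (intro bound) (simp add: add_nonneg_pos)
    also have "\<dots> \<le> \<epsilon>" using that by (simp add: divide_simps add_nonneg_pos)
    finally show ?thesis by simp
  qed
  thus ?thesis by (rule field_le_epsilon)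
qed

text \<open>The index set of the weighted family is the set of positions in the list.\<close>
lemma det_powr_conditionally_negative_list:
  fixes x y :: "'a \<Rightarrow> real" and cs :: "(real \<times> 'a) list"
  assumes p: "0 < p" "p < 2" and c: "(\<Sum>(c, u)\<leftarrow>cs. c * \<bar>x u\<bar> powr p) = 0"
  shows "(\<Sum>(c, u)\<leftarrow>cs. \<Sum>(d, w)\<leftarrow>cs. c * d * \<bar>x u * y w - x w * y u\<bar> powr p) \<le> 0"
proof -
  let ?I = "{0..<length cs}" and ?c = "\<lambda>i. fst (cs ! i)" and ?u = "\<lambda>i. snd (cs ! i)"
  have "(\<Sum>i\<in>?I. \<Sum>j\<in>?I. ?c i * ?c j * \<bar>x (?u i) * y (?u j) - x (?u j) * y (?u i)\<bar> powr p) \<le> 0"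
    using c by (intro det_powr_conditionally_negative[OF p])
               (simp add: sum_list_sum_nth case_prod_beta)
  thus ?thesis by (simp add: sum_list_sum_nth case_prod_beta)
qed

section \<open>Sums over subfamilies of a finite sequence\<close>

text \<open>
  The sum of \<open>g\<close> over all subsequences of length \<open>k\<close>, one for each set of \<open>k\<close> positions. The recursion
  on the list replaces the bookkeeping of index sets and makes concatenation and explicit evaluation
  easy.
\<close>
fun subseq_sum :: "nat \<Rightarrow> ('a list \<Rightarrow> real) \<Rightarrow> 'a list \<Rightarrow> real" where
  "subseq_sum 0 g xs = g []"
| "subseq_sum (Suc k) g [] = 0"
| "subseq_sum (Suc k) g (x # xs) = subseq_sum k (\<lambda>ys. g (x # ys)) xs + subseq_sum (Suc k) g xs"

lemma subseq_sum_cong: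
  assumes "\<And>ys. length ys = k \<Longrightarrow> set ys \<subseteq> set xs \<Longrightarrow> g ys = h ys"
  shows "subseq_sum k g xs = subseq_sum k h xs"
  using assms
proof (induction k g xs arbitrary: h rule: subseq_sum.induct)
  case (3 k g x xs)
  have "subseq_sum k (\<lambda>ys. g (x # ys)) xs = subseq_sum k (\<lambda>ys. h (x # ys)) xs"
    by (intro "3.IH"(1) "3.prems") auto
  moreover have "subseq_sum (Suc k) g xs = subseq_sum (Suc k) h xs"
    by (intro "3.IH"(2) "3.prems") auto
  ultimately show ?case by simp
qed auto

text \<open>
  A subset of the positions either contains the smallest one, which then heads its sorted list, or it
  does not: this is the recursion of \<open>subseq_sum\<close>.
\<close>
lemma sum_subsets_eq_subseq_sum:
  fixes js :: "nat list"
  assumes "sorted_wrt (<) js"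
  shows "(\<Sum>M | M \<subseteq> set js \<and> card M = k. g (map u (sorted_list_of_set M))) = subseq_sum k g (map u js)"
  using assms
proof (induction js arbitrary: k g)
  case Nil
  show ?case
  proof (cases k)
    case 0
    have sets: "{M. M \<subseteq> set [] \<and> card M = 0} = {{}}" by auto
    show ?thesis unfolding 0 sets by simp
  next
    case (Suc m)
    have sets: "{M. M \<subseteq> set [] \<and> card M = Suc m} = {}" by auto
    show ?thesis unfolding Suc sets by simp
  qed
next
  case (Cons i js)
  have sorted: "sorted_wrt (<) js" and less: "\<forall>j\<in>set js. i < j"
    using Cons.prems by simp_all
  hence i: "i \<notin> set js" by blast
  have fin: "finite M" if "M \<subseteq> set (i # js)" for M
    using that by (rule finite_subset) simp
  show ?case
  proof (cases k)
    case 0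
    have sets: "{M. M \<subseteq> set (i # js) \<and> card M = 0} = {{}}"
      by (intro equalityI subsetI) (metis (mono_tags) card_0_eq fin insertCI mem_Collect_eq, simp)
    show ?thesis unfolding 0 sets by simp
  next
    case (Suc m)
    let ?S = "\<lambda>k. {M. M \<subseteq> set js \<and> card M = k}"
    have fin': "finite M" if "M \<in> ?S k" for M k
      using that fin[of M] by (simp add: subset_insertI2)
    have "{M. M \<subseteq> set (i # js) \<and> card M = Suc m} = insert i ` ?S m \<union> ?S (Suc m)"
    proof (intro equalityI subsetI)
      fix M assume M: "M \<in> {M. M \<subseteq> set (i # js) \<and> card M = Suc m}"
      hence "finite M" using fin[of M] by simp
      show "M \<in> insert i ` ?S m \<union> ?S (Suc m)"
      proof (cases "i \<in> M")
        case True
        hence "M = insert i (M - {i})" "M - {i} \<in> ?S m" using M \<open>finite M\<close> by auto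
        thus ?thesis by blast
      next
        case False
        hence "M \<in> ?S (Suc m)" using M by auto
        thus ?thesis by blast
      qed
    next
      fix M assume "M \<in> insert i ` ?S m \<union> ?S (Suc m)"
      then consider M' where "M = insert i M'" "M' \<in> ?S m" | "M \<in> ?S (Suc m)" by blast
      thus "M \<in> {M. M \<subseteq> set (i # js) \<and> card M = Suc m}"
      proof cases
        case 1
        moreover have "i \<notin> M'" using 1 i by blast
        ultimately show ?thesis using fin'[of M'] by auto
      qed auto
    qed
    moreover have "inj_on (insert i) (?S m)"
      using i by (intro inj_onI) (metis (no_types, lifting) insert_ident mem_Collect_eq subsetD)
    moreover have "insert i ` ?S m \<inter> ?S (Suc m) = {}" using i by auto
    moreover have "sorted_list_of_set (insert i M) = i # sorted_list_of_set M" if "M \<in> ?S m" for M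
      using that i less fin'[OF that]
      by (subst sorted_list_of_set_insert) (auto intro!: insort_is_Cons less_imp_le)
    ultimately have "(\<Sum>M | M \<subseteq> set (i # js) \<and> card M = Suc m. g (map u (sorted_list_of_set M)))
        = (\<Sum>M\<in>?S m. g (u i # map u (sorted_list_of_set M))) + (\<Sum>M\<in>?S (Suc m). g (map u (sorted_list_of_set M)))"
      by (simp add: sum.union_disjoint sum.reindex)
    thus ?thesis
      using Cons.IH[OF sorted, of "\<lambda>ys. g (u i # ys)" m] Cons.IH[OF sorted, of g "Suc m"]
      by (simp add: Suc)
  qed
qed

lemma subseq_sum_snoc:
  "subseq_sum (Suc k) g (xs @ [x]) = subseq_sum (Suc k) g xs + subseq_sum k (\<lambda>ys. g (ys @ [x])) xs"
proof (induction xs arbitrary: k g)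
  case Nil
  show ?case by (cases k) auto
next
  case (Cons z xs)
  show ?case by (cases k) (simp_all add: Cons.IH)
qed

lemma subseq_sum_map: "subseq_sum k g (map f xs) = subseq_sum k (\<lambda>ys. g (map f ys)) xs"
proof (induction xs arbitrary: k g)
  case Nil
  show ?case by (cases k) auto
next
  case (Cons x xs)
  show ?case by (cases k) (simp_all add: Cons.IH)
qed

lemma subseq_sum_eq_0:
  assumes "\<And>ys. length ys = k \<Longrightarrow> set ys \<subseteq> set xs \<Longrightarrow> g ys = 0"
  shows "subseq_sum k g xs = 0"
proof -
  have "subseq_sum k (\<lambda>_. 0) xs = 0"
  proof (induction xs arbitrary: k)
    case Nil
    show ?case by (cases k) auto
  next
    case (Cons x xs)
    show ?case by (cases k) (simp_all add: Cons.IH)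
  qed
  moreover have "subseq_sum k g xs = subseq_sum k (\<lambda>_. 0) xs"
    by (intro subseq_sum_cong assms)
  ultimately show ?thesis by simp
qed

lemma subseq_sum_1: "subseq_sum (Suc 0) g xs = (\<Sum>x\<leftarrow>xs. g [x])"
  by (induction xs) auto

lemma double_subseq_sum_2:
  assumes "\<And>x y. g [x, y] = g [y, x]" "\<And>x. g [x, x] = 0"
  shows "2 * subseq_sum 2 g xs = (\<Sum>x\<leftarrow>xs. \<Sum>y\<leftarrow>xs. g [x, y])"
  unfolding numeral_2_eq_2
proof (induction xs)
  case (Cons z xs)
  have "(\<Sum>x\<leftarrow>xs. g [x, z]) = (\<Sum>x\<leftarrow>xs. g [z, x])"
    by (simp only: assms(1)[of _ z])
  thus ?case
    using Cons.IH by (simp add: subseq_sum_1 sum_list_addf assms(2) algebra_simps)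
qed simp

section \<open>The ratio in terms of ordinary determinants\<close>

text \<open>
  The parallelotope spanned by the projections has the same volume as the one spanned by the
  original vectors and the unit normal \<open>v\<close>. Algebraically, multiply the matrix with rows
  \<open>us, v\<close> by the transpose of the orthogonal matrix whose rows are a basis of the hyperplane followed by
  \<open>v\<close>: the product is block triangular with the coordinate matrix of the projections as one block.
\<close>
lemma abs_perp_det_eq_det_snoc:
  assumes v: "v \<in> unit_sphere n" and us: "length us = n - 1" "set us \<subseteq> carrier_vec n"
  shows "abs_perp_det n v us = \<bar>det (mat_of_rows n (us @ [v]))\<bar>"
proof -
  have vc: "v \<in> carrier_vec n" and vv: "v \<bullet> v = 1"
    using v by (auto simp: unit_sphere_iff)
  obtain m where n: "n = Suc m" using vv vc by (cases n) (auto simp: scalar_prod_def)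
  obtain bs where onb: "orthonormal_basis_perp n v bs"
    using orthonormal_basis_perp_exists[OF v] by blast
  hence bs: "length bs = m" "set bs \<subseteq> carrier_vec n" "\<And>b. b \<in> set bs \<Longrightarrow> b \<bullet> v = 0"
    "\<And>i j. i < m \<Longrightarrow> j < m \<Longrightarrow> bs ! i \<bullet> bs ! j = (if i = j then 1 else 0)"
    unfolding orthonormal_basis_perp_def by (auto simp: n)
  have bc: "bs ! j \<in> carrier_vec n" if "j < m" for j using bs that by auto
  have uc: "us ! j \<in> carrier_vec n" if "j < m" for j using us that n by auto
  have bv: "bs ! j \<bullet> v = 0" "v \<bullet> bs ! j = 0" if "j < m" for j
    using bs(1,3) that comm_scalar_prod[OF vc bc[OF that]] by auto
  define C where "C = mat_of_rows n (bs @ [v])"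
  define U where "U = mat_of_rows n (us @ [v])"
  have C: "C \<in> carrier_mat n n" and U: "U \<in> carrier_mat n n"
    using bs us by (auto simp: C_def U_def n mat_of_rows_def)
  have rC: "row C i = (if i < m then bs ! i else v)" if "i < n" for i
    using that bs vc bc by (auto simp: C_def n nth_append)
  have rU: "row U i = (if i < m then us ! i else v)" if "i < n" for i
    using that us vc uc by (auto simp: U_def n nth_append)
  have "C * C\<^sup>T = 1\<^sub>m n"
    using C bs bv vv by (intro eq_matI) (auto simp: rC n less_Suc_eq)
  hence "det C * det C = 1"
    using C by (metis det_mult det_one det_transpose transpose_carrier_mat)
  hence detC: "\<bar>det C\<bar> = 1"
    by (metis abs_mult_self_eq abs_square_eq_1 power2_eq_square)
  define K where "K = mat m m (\<lambda>(i, j). us ! i \<bullet> bs ! j)"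
  have "U * C\<^sup>T = four_block_mat K (mat m 1 (\<lambda>(i, j). us ! i \<bullet> v)) (0\<^sub>m 1 m) (1\<^sub>m 1)"
    using U C vv bv by (intro eq_matI) (auto simp: rC rU n K_def less_Suc_eq)
  hence "det (U * C\<^sup>T) = det K"
    by (simp add: det_four_block_mat_lower_left_zero[where n = m and m = 1] K_def del: One_nat_def)
  hence "det U * det C = det K"
    using U C by (simp add: det_mult[of _ n] det_transpose)
  hence "\<bar>det U\<bar> = \<bar>det K\<bar>"
    using detC by (metis abs_mult mult.right_neutral)
  moreover have "coord_det n bs (map (proj_perp v) us) = det K"
  proof -
    have "proj_perp v (us ! i) \<bullet> bs ! j = us ! i \<bullet> bs ! j" if "i < m" "j < m" for i j
      using uc[OF that(1)] bc[OF that(2)] vc bv[OF that(2)]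
      by (simp add: proj_perp_def minus_scalar_prod_distrib[of _ n])
    thus ?thesis
      using us by (auto simp: coord_det_def K_def n intro!: arg_cong[of _ _ det] eq_matI)
  qed
  ultimately show ?thesis
    using abs_coord_det_eq[OF v onb us] by (simp add: U_def)
qed

definition list_ratio :: "nat \<Rightarrow> real \<Rightarrow> real vec \<Rightarrow> real vec list \<Rightarrow> real" where
  "list_ratio n p v xs =
     subseq_sum n (\<lambda>ys. \<bar>det (mat_of_rows n ys)\<bar> powr p) xs /
     subseq_sum (n - 1) (\<lambda>ys. \<bar>det (mat_of_rows n (ys @ [v]))\<bar> powr p) xs"

lemma det_ratio_eq_list_ratio:
  assumes v: "v \<in> unit_sphere n" and u: "\<And>i. i \<in> {a..b} \<Longrightarrow> u i \<in> carrier_vec n"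
  shows "det_ratio n p u v a b = list_ratio n p v (map u [a..<Suc b])"
proof -
  have set: "set [a..<Suc b] = {a..b}" by auto
  have "subseq_sum (n - 1) (\<lambda>ys. abs_perp_det n v ys powr p) (map u [a..<Suc b])
      = subseq_sum (n - 1) (\<lambda>ys. \<bar>det (mat_of_rows n (ys @ [v]))\<bar> powr p) (map u [a..<Suc b])"
  proof (rule subseq_sum_cong)
    fix ys assume "length ys = n - 1" "set ys \<subseteq> set (map u [a..<Suc b])"
    moreover have "set (map u [a..<Suc b]) \<subseteq> carrier_vec n" using u by auto
    ultimately show "abs_perp_det n v ys powr p = \<bar>det (mat_of_rows n (ys @ [v]))\<bar> powr p"
      by (subst abs_perp_det_eq_det_snoc[OF v]) auto
  qed
  thus ?thesis
    using sum_subsets_eq_subseq_sum[OF sorted_wrt_upt[of a "Suc b"], of "\<lambda>ys. \<bar>det (mat_of_rows n ys)\<bar> powr p" u n]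
      sum_subsets_eq_subseq_sum[OF sorted_wrt_upt[of a "Suc b"], of "\<lambda>ys. abs_perp_det n v ys powr p" u "n - 1"]
    unfolding det_ratio_def list_ratio_def set by simp
qed

lemma det_dim_2:
  fixes A :: "real mat"
  assumes A: "A \<in> carrier_mat 2 2"
  shows "det A = A $$ (0, 0) * A $$ (1, 1) - A $$ (0, 1) * A $$ (1, 0)"
proof -
  have "det (mat_delete A 0 j) = A $$ (1, 1 - j)" if "j < 2" for j
    using A that by (subst det_single) (auto simp: mat_delete_def less_2_cases_iff)
  thus ?thesis
    using laplace_expansion_row[OF A, of 0] by (simp add: numeral_2_eq_2 cofactor_def)
qed

lemma det_dim_3:
  fixes A :: "real mat"
  assumes A: "A \<in> carrier_mat 3 3"
  shows "det A = A $$ (0, 0) * (A $$ (1, 1) * A $$ (2, 2) - A $$ (1, 2) * A $$ (2, 1))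
    - A $$ (0, 1) * (A $$ (1, 0) * A $$ (2, 2) - A $$ (1, 2) * A $$ (2, 0))
    + A $$ (0, 2) * (A $$ (1, 0) * A $$ (2, 1) - A $$ (1, 1) * A $$ (2, 0))"
proof -
  have "mat_delete A 0 j \<in> carrier_mat 2 2" for j
    using A by (simp add: mat_delete_def)
  hence minor: "cofactor A 0 j = (- 1) ^ j * (mat_delete A 0 j $$ (0, 0) * mat_delete A 0 j $$ (1, 1)
      - mat_delete A 0 j $$ (0, 1) * mat_delete A 0 j $$ (1, 0))" for j
    by (simp add: cofactor_def det_dim_2)
  have entry: "mat_delete A 0 j $$ (i, k) = A $$ (Suc i, if k < j then k else Suc k)"
    if "i < 2" "k < 2" for i j k
    using A that by (simp add: mat_delete_def)
  have "det A = (\<Sum>j<Suc (Suc (Suc 0)). A $$ (0, j) * cofactor A 0 j)"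
    using laplace_expansion_row[OF A, of 0] by (simp only: numeral_3_eq_3)
  thus ?thesis
    by (simp add: minor entry numeral_2_eq_2 algebra_simps)
qed

lemma det_mat_of_rows_2:
  "det (mat_of_rows 2 [u, w]) = u $ 0 * w $ 1 - u $ 1 * w $ 0" for u w :: "real vec"
proof -
  define A where "A = mat_of_rows 2 [u, w]"
  have A: "A \<in> carrier_mat 2 2" unfolding A_def by (rule carrier_matI) simp_all
  have "A $$ (0, j) = u $ j" "A $$ (1, j) = w $ j" if "j < 2" for j
    using that by (simp_all add: A_def mat_of_rows_def)
  thus ?thesis unfolding A_def[symmetric] det_dim_2[OF A] by simp
qed

lemma det_mat_of_rows_3:
  "det (mat_of_rows 3 [u, v, w]) = u $ 0 * (v $ 1 * w $ 2 - v $ 2 * w $ 1)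
    - u $ 1 * (v $ 0 * w $ 2 - v $ 2 * w $ 0) + u $ 2 * (v $ 0 * w $ 1 - v $ 1 * w $ 0)"
  for u v w :: "real vec"
proof -
  define A where "A = mat_of_rows 3 [u, v, w]"
  have A: "A \<in> carrier_mat 3 3" unfolding A_def by (rule carrier_matI) simp_all
  have "A $$ (0, j) = u $ j" "A $$ (1, j) = v $ j" "A $$ (2, j) = w $ j" if "j < 3" for j
    using that by (simp_all add: A_def mat_of_rows_def)
  thus ?thesis unfolding A_def[symmetric] det_dim_3[OF A] by simp
qed

section \<open>Superadditivity in the plane\<close>

text \<open>
  In this proof \<open>F\<close> and \<open>D\<close> are numerator and denominator of the ratio, and \<open>C\<close> collects the pairs
  with one vector from each family. If a denominator vanishes, the corresponding ratio is \<open>0\<close> by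
  convention and monotonicity of the numerator suffices.
\<close>
lemma list_ratio_2_superadditive:
  assumes p: "0 < p" "p < 2" and v: "v \<in> unit_sphere 2"
  shows "list_ratio 2 p v xs + list_ratio 2 p v ys \<le> list_ratio 2 p v (xs @ ys)"
proof -
  define g where "g = (\<lambda>us. \<bar>det (mat_of_rows 2 us)\<bar> powr p)"
  define x where "x = (\<lambda>u :: real vec. u $ 0 * v $ 1 - u $ 1 * v $ 0)"
  define y where "y = (\<lambda>u :: real vec. u $ 0 * v $ 0 + u $ 1 * v $ 1)"
  define F where "F = subseq_sum 2 g"
  define D where "D = (\<lambda>us. \<Sum>u\<leftarrow>us. \<bar>x u\<bar> powr p)"
  define C where "C = (\<Sum>u\<leftarrow>xs. \<Sum>w\<leftarrow>ys. g [u, w])"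
  have vv: "v $ 0 * v $ 0 + v $ 1 * v $ 1 = 1"
    using v by (auto simp: unit_sphere_iff scalar_prod_def numeral_2_eq_2)
  have ratio: "list_ratio 2 p v us = F us / D us" for us
    by (simp add: list_ratio_def F_def D_def g_def subseq_sum_1 det_mat_of_rows_2 x_def)
  have g: "g [u, w] = \<bar>x u * y w - x w * y u\<bar> powr p" for u w
  proof -
    have "x u * y w - x w * y u = (u $ 0 * w $ 1 - u $ 1 * w $ 0) * (v $ 0 * v $ 0 + v $ 1 * v $ 1)"
      unfolding x_def y_def by (simp add: algebra_simps)
    thus ?thesis unfolding vv mult_1_right by (simp only: g_def det_mat_of_rows_2)
  qed
  have sym: "g [u, w] = g [w, u]" and diag: "g [u, u] = 0" for u w
    by (simp_all add: g abs_minus_commute)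
  have double: "2 * F us = (\<Sum>u\<leftarrow>us. \<Sum>w\<leftarrow>us. g [u, w])" for us
    unfolding F_def by (rule double_subseq_sum_2) (rule sym diag)+
  have swap: "(\<Sum>w\<leftarrow>ys. \<Sum>u\<leftarrow>xs. g [w, u]) = C"
  proof -
    have "(\<Sum>w\<leftarrow>ys. \<Sum>u\<leftarrow>xs. g [w, u]) = (\<Sum>w\<leftarrow>ys. \<Sum>u\<leftarrow>xs. g [u, w])"
      by (simp only: sym)
    also have "\<dots> = C"
      unfolding C_def by (induction ys) (simp_all add: sum_list_addf)
    finally show ?thesis .
  qed
  have F_append: "F (xs @ ys) = F xs + F ys + C"
    using double[of "xs @ ys"] double[of xs] double[of ys] swap
    by (simp add: sum_list_addf C_def[symmetric])
  have D_append: "D (xs @ ys) = D xs + D ys" by (simp add: D_def)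
  have D0: "0 \<le> D us" for us unfolding D_def by (auto intro!: sum_list_nonneg)
  have F0: "0 \<le> F us" for us
  proof -
    have "0 \<le> (\<Sum>u\<leftarrow>us. \<Sum>w\<leftarrow>us. g [u, w])"
      by (auto simp: g intro!: sum_list_nonneg)
    thus ?thesis using double[of us] by linarith
  qed
  have C0: "0 \<le> C" unfolding C_def by (auto simp: g intro!: sum_list_nonneg)
  (* The conditionally negative kernel at the weights D ys on xs and - D xs on ys. *)
  have energy: "(D ys)\<^sup>2 * F xs + (D xs)\<^sup>2 * F ys \<le> D xs * D ys * C"
  proof -
    define cs where "cs = (\<lambda>a b :: real. map (Pair a) xs @ map (Pair b) ys)"
    have weights: "(\<Sum>(c, u)\<leftarrow>cs a b. c * \<bar>x u\<bar> powr p) = a * D xs + b * D ys" for a b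
      by (simp add: cs_def o_def sum_list_const_mult D_def)
    have form: "(\<Sum>(c, u)\<leftarrow>cs a b. \<Sum>(d, w)\<leftarrow>cs a b. c * d * g [u, w])
        = a\<^sup>2 * (2 * F xs) + b\<^sup>2 * (2 * F ys) + 2 * (a * b * C)" for a b
      unfolding double cs_def using swap
      by (simp add: o_def sum_list_addf sum_list_const_mult mult.assoc C_def[symmetric] power2_eq_square)
    have "(\<Sum>(c, u)\<leftarrow>cs (D ys) (- D xs). \<Sum>(d, w)\<leftarrow>cs (D ys) (- D xs). c * d * g [u, w]) \<le> 0"
      unfolding g by (intro det_powr_conditionally_negative_list[OF p]) (simp add: weights)
    thus ?thesis unfolding form by (simp add: algebra_simps)
  qed
  show ?thesis
  proof (cases "D xs = 0 \<or> D ys = 0")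
    case True
    thus ?thesis using D0 F0 C0 unfolding ratio F_append D_append
      by (auto intro!: divide_right_mono)
  next
    case False
    hence pos: "0 < D xs" "0 < D ys" using D0[of xs] D0[of ys] by linarith+
    have "F xs / D xs + F ys / D ys = (F xs * D ys + F ys * D xs) / (D xs * D ys)"
      using pos by (simp add: field_simps)
    also have "\<dots> \<le> (F xs + F ys + C) / (D xs + D ys)"
    proof -
      have "(F xs * D ys + F ys * D xs) * (D xs + D ys) \<le> (F xs + F ys + C) * (D xs * D ys)"
        using energy by (simp add: algebra_simps power2_eq_square)
      thus ?thesis using pos by (simp add: divide_le_eq le_divide_eq field_simps)
    qed
    finally show ?thesis unfolding ratio F_append D_append .
  qed
qed

section \<open>A violation in dimension three\<close>

text \<open>
  Equality holds at \<open>p = 2\<close>, and \<open>3\<^sup>p - 2\<^sup>p = 2\<^sup>p ((3/2)\<^sup>p - 1)\<close> is a product of increasing factors.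
\<close>
lemma three_powr_less:
  fixes p :: real
  assumes "0 < p" "p < 2"
  shows "3 powr p < 5 + 2 powr p"
proof -
  have three: "3 powr p = 2 powr p * (3 / 2) powr p"
    by (simp flip: powr_mult)
  have "2 powr p < 2 powr 2" "(3 / 2) powr p < (3 / 2 :: real) powr 2"
    by (rule powr_less_mono; use assms in simp)+
  hence lt: "2 powr p < 4" "(3 / 2) powr p < (9 / 4 :: real)"
    by (simp_all add: power2_eq_square)
  have "1 \<le> (3 / 2 :: real) powr p"
    using assms by (intro ge_one_powr_ge_zero) auto
  hence "2 powr p * ((3 / 2) powr p - 1) \<le> 4 * ((3 / 2 :: real) powr p - 1)"
    using lt by (intro mult_right_mono) auto
  also have "\<dots> < 5" using lt by simp
  finally show ?thesis unfolding three by (simp add: right_diff_distrib)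
qed

definition vec3 :: "real \<Rightarrow> real \<Rightarrow> real \<Rightarrow> real vec" where
  "vec3 a b t = vec 3 (\<lambda>i. [a, b, t] ! i)"

text \<open>
  The vertical line over the plane vector \<open>(a, b)\<close>, carrying the slopes \<open>-1, 0, 1\<close> with weights
  \<open>1, 2, 1\<close>.
\<close>
definition line :: "real \<Rightarrow> real \<Rightarrow> real vec list" where
  "line a b = [vec3 a b (- 1), vec3 a b 0, vec3 a b 0, vec3 a b 1]"

lemma det_vec3:
  "det (mat_of_rows 3 [vec3 a b t, vec3 c d s, vec3 e f r])
    = a * (d * r - s * f) - b * (c * r - s * e) + t * (c * f - d * e)"
  unfolding det_mat_of_rows_3 by (simp add: vec3_def)

text \<open>
  With \<open>q = 2\<^sup>p\<close>, the pairs inside one line contribute \<open>4 + q\<close>. The numerators and denominators are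
  \<open>32 + 8 q\<close> over \<open>16\<close>, \<open>4 + q\<close> over \<open>4\<close>, and \<open>158 + 40 q + 2 \<cdot> 3\<^sup>p\<close> over \<open>56\<close>; the term \<open>3\<^sup>p\<close> comes from
  the two triples with all slopes \<open>1\<close> or all slopes \<open>-1\<close>. The single vector \<open>(1, 0, 0)\<close> in \<open>ys\<close> makes
  the denominator of the second family nonzero.
\<close>
lemma list_ratio_3:
  assumes p: "0 < p"
  defines "v \<equiv> vec3 0 0 1"
    and "xs \<equiv> line 1 0 @ line 0 1" and "ys \<equiv> vec3 1 0 0 # line (- 1) (- 1)"
  shows "list_ratio 3 p v xs = (4 + 2 powr p) / 2"
    and "list_ratio 3 p v ys = (4 + 2 powr p) / 4"
    and "list_ratio 3 p v (xs @ ys) = (158 + 40 * 2 powr p + 2 * 3 powr p) / 56"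
proof -
  have eval: "list_ratio 3 p v us = subseq_sum (Suc (Suc (Suc 0))) (\<lambda>ys. \<bar>det (mat_of_rows 3 ys)\<bar> powr p) us /
     subseq_sum (Suc (Suc 0)) (\<lambda>ys. \<bar>det (mat_of_rows 3 (ys @ [v]))\<bar> powr p) us" for us
    by (simp add: list_ratio_def numeral_3_eq_3 numeral_2_eq_2)
  show "list_ratio 3 p v xs = (4 + 2 powr p) / 2"
    unfolding eval using p by (simp add: v_def xs_def line_def det_vec3)
  show "list_ratio 3 p v ys = (4 + 2 powr p) / 4"
    unfolding eval using p by (simp add: v_def ys_def line_def det_vec3)
  show "list_ratio 3 p v (xs @ ys) = (158 + 40 * 2 powr p + 2 * 3 powr p) / 56"
    unfolding eval using p by (simp add: v_def xs_def ys_def line_def det_vec3)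
qed

section \<open>Raising the dimension\<close>

text \<open>Laplace expansion along the unit row; its position only affects the sign.\<close>
lemma abs_det_insert_unit_row:
  assumes len: "length ys + length zs = n"
  shows "\<bar>det (mat_of_rows (Suc n) (map (vCons 0) ys @ unit_vec (Suc n) 0 # map (vCons 0) zs))\<bar>
    = \<bar>det (mat_of_rows n (ys @ zs) :: real mat)\<bar>"
proof -
  define us where "us = map (vCons (0 :: real)) ys @ unit_vec (Suc n) 0 # map (vCons 0) zs"
  define A where "A = mat_of_rows (Suc n) us"
  let ?i = "length ys"
  have A: "A \<in> carrier_mat (Suc n) (Suc n)"
    using len by (simp add: A_def us_def mat_of_rows_def)
  have "det A = (\<Sum>j<Suc n. A $$ (?i, j) * cofactor A ?i j)"
    using len by (intro laplace_expansion_row[OF A]) simp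
  also have "\<dots> = (\<Sum>j<Suc n. if j = 0 then cofactor A ?i j else 0)"
    using len by (intro sum.cong refl) (auto simp: A_def us_def mat_of_rows_def nth_append unit_vec_def)
  also have "\<dots> = (- 1) ^ ?i * det (mat_delete A ?i 0)"
    by (simp add: cofactor_def)
  also have "mat_delete A ?i 0 = mat_of_rows n (ys @ zs)"
    using len
    by (intro eq_matI)
       (auto simp: mat_delete_def A_def us_def mat_of_rows_def nth_append)
  finally show ?thesis by (simp add: abs_mult power_abs A_def us_def)
qed

lemma det_zero_column:
  assumes "length ys = Suc n"
  shows "det (mat_of_rows (Suc n) (map (vCons 0) ys) :: real mat) = 0"
proof -
  define A where "A = mat_of_rows (Suc n) (map (vCons (0 :: real)) ys)"
  have A: "A \<in> carrier_mat (Suc n) (Suc n)"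
    using assms by (simp add: A_def mat_of_rows_def)
  have "det A = (\<Sum>i<Suc n. A $$ (i, 0) * cofactor A i 0)"
    by (intro laplace_expansion_column[OF A]) simp
  also have "\<dots> = 0"
    using assms by (intro sum.neutral) (auto simp: A_def mat_of_rows_def)
  finally show ?thesis by (simp add: A_def)
qed

lemma det_repeated_row:
  assumes "Suc (Suc (length ys + length zs)) = n" and x: "x \<in> carrier_vec n"
  shows "det (mat_of_rows n (x # ys @ x # zs) :: real mat) = 0"
proof (rule det_identical_rows)
  show "mat_of_rows n (x # ys @ x # zs) \<in> carrier_mat n n"
    using assms by (simp add: mat_of_rows_def)
  show "row (mat_of_rows n (x # ys @ x # zs)) 0 = row (mat_of_rows n (x # ys @ x # zs)) (Suc (length ys))"
    using assms by (simp add: nth_append)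
qed (use assms in auto)

text \<open>
  Embed \<open>\<real>\<^sup>n\<close> into \<open>\<real>\<^bsup>n+1\<^esup>\<close> as the last \<open>n\<close> coordinates and adjoin the first unit vector \<open>e\<close> to a family. A
  subfamily without \<open>e\<close> has determinant \<open>0\<close>, and one with \<open>e\<close> has the determinant of its other members, up
  to sign: in terms of linear dependence, \<open>e\<close> is a coloop. With \<open>e\<close> at both ends, exactly one of the
  two copies must be chosen. The fixed rows \<open>vs\<close> allow for the vector \<open>v\<close> in the denominator of the ratio.
\<close>
context
  fixes n k :: nat and p :: real and vs :: "real vec list"
  assumes k: "Suc k + length vs = n"
begin

lemma subseq_sum_coloop_front:
  "subseq_sum (Suc (Suc k)) (\<lambda>ys. \<bar>det (mat_of_rows (Suc n) (ys @ map (vCons 0) vs))\<bar> powr p)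
      (unit_vec (Suc n) 0 # map (vCons 0) xs)
    = subseq_sum (Suc k) (\<lambda>ys. \<bar>det (mat_of_rows n (ys @ vs))\<bar> powr p) xs"
proof -
  have "subseq_sum (Suc k) (\<lambda>ys. \<bar>det (mat_of_rows (Suc n) (unit_vec (Suc n) 0 # map (vCons 0) ys @ map (vCons 0) vs))\<bar> powr p) xs
    = subseq_sum (Suc k) (\<lambda>ys. \<bar>det (mat_of_rows n (ys @ vs))\<bar> powr p) xs"
    using k abs_det_insert_unit_row[of "[]" _ n]
    by (intro subseq_sum_cong) (simp flip: map_append)
  moreover have "subseq_sum (Suc (Suc k)) (\<lambda>ys. \<bar>det (mat_of_rows (Suc n) (map (vCons 0) ys @ map (vCons 0) vs))\<bar> powr p) xs = 0"
    using k by (intro subseq_sum_eq_0) (simp add: det_zero_column flip: map_append)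
  ultimately show ?thesis by (simp add: subseq_sum_map)
qed

lemma subseq_sum_coloop_back:
  "subseq_sum (Suc (Suc k)) (\<lambda>ys. \<bar>det (mat_of_rows (Suc n) (ys @ map (vCons 0) vs))\<bar> powr p)
      (map (vCons 0) xs @ [unit_vec (Suc n) 0])
    = subseq_sum (Suc k) (\<lambda>ys. \<bar>det (mat_of_rows n (ys @ vs))\<bar> powr p) xs"
proof -
  have "subseq_sum (Suc k) (\<lambda>ys. \<bar>det (mat_of_rows (Suc n) (map (vCons 0) ys @ unit_vec (Suc n) 0 # map (vCons 0) vs))\<bar> powr p) xs
    = subseq_sum (Suc k) (\<lambda>ys. \<bar>det (mat_of_rows n (ys @ vs))\<bar> powr p) xs"
    using k by (intro subseq_sum_cong) (simp add: abs_det_insert_unit_row)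
  moreover have "subseq_sum (Suc (Suc k)) (\<lambda>ys. \<bar>det (mat_of_rows (Suc n) (map (vCons 0) ys @ map (vCons 0) vs))\<bar> powr p) xs = 0"
    using k by (intro subseq_sum_eq_0) (simp add: det_zero_column flip: map_append)
  ultimately show ?thesis by (simp add: subseq_sum_snoc subseq_sum_map)
qed

lemma subseq_sum_coloop_both:
  "subseq_sum (Suc (Suc k)) (\<lambda>ys. \<bar>det (mat_of_rows (Suc n) (ys @ map (vCons 0) vs))\<bar> powr p)
      (unit_vec (Suc n) 0 # map (vCons 0) xs @ [unit_vec (Suc n) 0])
    = 2 * subseq_sum (Suc k) (\<lambda>ys. \<bar>det (mat_of_rows n (ys @ vs))\<bar> powr p) xs"
proof -
  let ?e = "unit_vec (Suc n) 0 :: real vec"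
  let ?H = "\<lambda>ys. \<bar>det (mat_of_rows (Suc n) (ys @ map (vCons 0) vs))\<bar> powr p"
  let ?L = "map (vCons 0) xs"
  have "subseq_sum k (\<lambda>ys. ?H (?e # ys @ [?e])) ?L = 0"
    using k by (intro subseq_sum_eq_0) (simp add: det_repeated_row)
  hence "subseq_sum (Suc k) (\<lambda>ys. ?H (?e # ys)) (?L @ [?e]) = subseq_sum (Suc k) (\<lambda>ys. ?H (?e # ys)) ?L"
    by (simp add: subseq_sum_snoc)
  moreover have "subseq_sum (Suc (Suc k)) ?H ?L = 0"
    using k unfolding subseq_sum_map
    by (intro subseq_sum_eq_0) (simp add: det_zero_column flip: map_append)
  hence "subseq_sum (Suc k) (\<lambda>ys. ?H (?e # ys)) ?L = subseq_sum (Suc (Suc k)) ?H (?e # ?L)"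
    by simp
  ultimately show ?thesis
    using subseq_sum_coloop_front[of xs] subseq_sum_coloop_back[of xs] by simp
qed

end

text \<open>
  Numerator and denominator of the ratio are the cases \<open>vs = []\<close> and \<open>vs = [v]\<close> of the preceding lemmas.
  For the third family both are doubled.
\<close>
lemma list_ratio_coloop:
  assumes n: "2 \<le> n"
  shows "list_ratio (Suc n) p (vCons 0 v) (unit_vec (Suc n) 0 # map (vCons 0) xs) = list_ratio n p v xs"
    and "list_ratio (Suc n) p (vCons 0 v) (map (vCons 0) xs @ [unit_vec (Suc n) 0]) = list_ratio n p v xs"
    and "list_ratio (Suc n) p (vCons 0 v) (unit_vec (Suc n) 0 # map (vCons 0) xs @ [unit_vec (Suc n) 0]) = list_ratio n p v xs"
proof -
  obtain m where m: "n = Suc (Suc m)" using n by (metis add_2_eq_Suc le_Suc_ex)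
  note num = subseq_sum_coloop_front[where k = "Suc m" and vs = "[]" and n = n and p = p and xs = xs]
    subseq_sum_coloop_back[where k = "Suc m" and vs = "[]" and n = n and p = p and xs = xs]
    subseq_sum_coloop_both[where k = "Suc m" and vs = "[]" and n = n and p = p and xs = xs]
  note den = subseq_sum_coloop_front[where k = m and vs = "[v]" and n = n and p = p and xs = xs]
    subseq_sum_coloop_back[where k = m and vs = "[v]" and n = n and p = p and xs = xs]
    subseq_sum_coloop_both[where k = m and vs = "[v]" and n = n and p = p and xs = xs]
  show "list_ratio (Suc n) p (vCons 0 v) (unit_vec (Suc n) 0 # map (vCons 0) xs) = list_ratio n p v xs"
    using num(1) den(1) unfolding m list_ratio_def by (simp del: subseq_sum.simps)
  show "list_ratio (Suc n) p (vCons 0 v) (map (vCons 0) xs @ [unit_vec (Suc n) 0]) = list_ratio n p v xs"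
    using num(2) den(2) unfolding m list_ratio_def by (simp del: subseq_sum.simps)
  show "list_ratio (Suc n) p (vCons 0 v) (unit_vec (Suc n) 0 # map (vCons 0) xs @ [unit_vec (Suc n) 0]) = list_ratio n p v xs"
    using num(3) den(3) unfolding m list_ratio_def by (simp del: subseq_sum.simps)
qed

lemma list_ratio_not_superadditive:
  assumes p: "0 < p" "p < 2" and n: "3 \<le> n"
  shows "\<exists>v xs ys. v \<in> unit_sphere n \<and> set (xs @ ys) \<subseteq> carrier_vec n \<and> xs \<noteq> [] \<and> ys \<noteq> [] \<and>
    list_ratio n p v (xs @ ys) < list_ratio n p v xs + list_ratio n p v ys"
  using n
proof (induction n rule: dec_induct)
  case base
  define v where "v = vec3 0 0 1"
  define xs where "xs = line 1 0 @ line 0 1"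
  define ys where "ys = vec3 1 0 0 # line (- 1) (- 1)"
  have "list_ratio 3 p v (xs @ ys) < list_ratio 3 p v xs + list_ratio 3 p v ys"
    using three_powr_less[OF p] unfolding v_def xs_def ys_def list_ratio_3[OF p(1)]
    by (simp add: field_simps)
  moreover have "v \<in> unit_sphere 3"
    by (simp add: unit_sphere_iff v_def vec3_def scalar_prod_def numeral_3_eq_3)
  moreover have "set (xs @ ys) \<subseteq> carrier_vec 3" "xs \<noteq> []" "ys \<noteq> []"
    by (auto simp: xs_def ys_def line_def vec3_def)
  ultimately show ?case by blast
next
  case (step n)
  then obtain v xs ys where v: "v \<in> unit_sphere n" and car: "set (xs @ ys) \<subseteq> carrier_vec n"
    and ne: "xs \<noteq> []" "ys \<noteq> []"
    and less: "list_ratio n p v (xs @ ys) < list_ratio n p v xs + list_ratio n p v ys"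
    by blast
  define e where "e = (unit_vec (Suc n) 0 :: real vec)"
  (* Placed at the two outer ends, the copies of e leave each family contiguous. *)
  define xs' where "xs' = e # map (vCons 0) xs"
  define ys' where "ys' = map (vCons 0) ys @ [e]"
  have n: "2 \<le> n" using step.hyps by simp
  have cars: "set xs \<subseteq> carrier_vec n" "set ys \<subseteq> carrier_vec n" using car by auto
  have append: "xs' @ ys' = e # map (vCons 0) (xs @ ys) @ [e]" by (simp add: xs'_def ys'_def)
  have "list_ratio (Suc n) p (vCons 0 v) (xs' @ ys')
      < list_ratio (Suc n) p (vCons 0 v) xs' + list_ratio (Suc n) p (vCons 0 v) ys'"
    unfolding append unfolding xs'_def ys'_def e_def
    using less list_ratio_coloop(1)[OF n, of p v xs] list_ratio_coloop(2)[OF n, of p v ys]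
      list_ratio_coloop(3)[OF n, of p v "xs @ ys"] by (simp only:)
  moreover have "vCons 0 v \<in> unit_sphere (Suc n)"
    using v by (simp add: unit_sphere_iff)
  moreover have "set (xs' @ ys') \<subseteq> carrier_vec (Suc n)" "xs' \<noteq> []" "ys' \<noteq> []"
    using cars by (auto simp: xs'_def ys'_def e_def)
  ultimately show ?case by blast
qed

section \<open>From lists back to indexed sequences\<close>

theorem theorem3:
  fixes p :: real
  assumes "0 < p" and "p < 2"
  shows "(\<forall>(N'::nat) (N::nat) (u :: nat \<Rightarrow> real vec) (v :: real vec).
            1 \<le> N' \<longrightarrow> N' < N \<longrightarrow> (\<forall>i\<in>{1..N}. u i \<in> carrier_vec 2) \<longrightarrow> v \<in> unit_sphere 2 \<longrightarrow>
              det_ratio 2 p u v 1 N \<ge> det_ratio 2 p u v 1 N' + det_ratio 2 p u v (N' + 1) N)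
       \<and> (\<forall>n::nat. n \<ge> 3 \<longrightarrow>
            (\<exists>(N'::nat) (N::nat) (u :: nat \<Rightarrow> real vec) (v :: real vec).
              1 \<le> N' \<and> N' < N \<and> (\<forall>i\<in>{1..N}. u i \<in> carrier_vec n) \<and> v \<in> unit_sphere n \<and>
              det_ratio n p u v 1 N < det_ratio n p u v 1 N' + det_ratio n p u v (N' + 1) N))"
proof (intro conjI allI impI)
  fix N' N :: nat and u :: "nat \<Rightarrow> real vec" and v :: "real vec"
  assume N: "1 \<le> N'" "N' < N" and u: "\<forall>i\<in>{1..N}. u i \<in> carrier_vec 2" and v: "v \<in> unit_sphere 2"
  have "[1..<Suc N] = [1..<Suc N'] @ [N' + 1..<Suc N]"
    using N upt_add_eq_append[of 1 "Suc N'" "N - N'"] by simp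
  hence split: "map u [1..<Suc N] = map u [1..<Suc N'] @ map u [N' + 1..<Suc N]"
    by (simp only: map_append)
  have "det_ratio 2 p u v a b = list_ratio 2 p v (map u [a..<Suc b])"
    if "1 \<le> a" "b \<le> N" for a b
    using that u by (intro det_ratio_eq_list_ratio[OF v]) auto
  hence ratios: "det_ratio 2 p u v 1 N = list_ratio 2 p v (map u [1..<Suc N])"
    "det_ratio 2 p u v 1 N' = list_ratio 2 p v (map u [1..<Suc N'])"
    "det_ratio 2 p u v (N' + 1) N = list_ratio 2 p v (map u [N' + 1..<Suc N])"
    using N by simp_all
  show "det_ratio 2 p u v 1 N \<ge> det_ratio 2 p u v 1 N' + det_ratio 2 p u v (N' + 1) N"
    unfolding ratios split by (rule list_ratio_2_superadditive[OF assms v])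
next
  fix n :: nat assume "3 \<le> n"
  then obtain v xs ys where v: "v \<in> unit_sphere n" and car: "set (xs @ ys) \<subseteq> carrier_vec n"
    and ne: "xs \<noteq> []" "ys \<noteq> []"
    and less: "list_ratio n p v (xs @ ys) < list_ratio n p v xs + list_ratio n p v ys"
    using list_ratio_not_superadditive[OF assms] by blast
  define N' where "N' = length xs"
  define N where "N = length (xs @ ys)"
  define u where "u = (\<lambda>i. (xs @ ys) ! (i - 1))"
  have N: "1 \<le> N'" "N' < N" using ne by (auto simp: N'_def N_def Suc_le_eq)
  have u: "u i \<in> carrier_vec n" if "i \<in> {1..N}" for i
    using car that nth_mem[of "i - 1" "xs @ ys"] by (auto simp: u_def N_def simp del: set_append)
  have maps: "map u [1..<Suc N] = xs @ ys" "map u [1..<Suc N'] = xs" "map u [N' + 1..<Suc N] = ys"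
    by (auto intro!: nth_equalityI simp: u_def N_def N'_def nth_append simp del: upt_Suc)
  have "det_ratio n p u v a b = list_ratio n p v (map u [a..<Suc b])"
    if "1 \<le> a" "b \<le> N" for a b
    using that u by (intro det_ratio_eq_list_ratio[OF v]) auto
  hence "det_ratio n p u v 1 N < det_ratio n p u v 1 N' + det_ratio n p u v (N' + 1) N"
    using less N maps by simp
  thus "\<exists>(N'::nat) (N::nat) (u :: nat \<Rightarrow> real vec) (v :: real vec).
      1 \<le> N' \<and> N' < N \<and> (\<forall>i\<in>{1..N}. u i \<in> carrier_vec n) \<and> v \<in> unit_sphere n \<and>
      det_ratio n p u v 1 N < det_ratio n p u v 1 N' + det_ratio n p u v (N' + 1) N"
    using N u v by blast
qed

end
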